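(* Let $\mathcal{A}$ be an indexing collection on $\mathcal{T}$. If $\mathcal{A}$ is totally ordered by inclusion, then the cardinality of $\mathcal{A}$ cannot exceed the cardinality of $\mathbf{R}$.
   Context: Setting: $\mathcal{T}$ is a locally compact metric space equipped with a Radon measure $m$; $\overline{(\cdot)}$ denotes closure and $(\cdot)^\circ$ interior. For a class $\mathcal{D}$ of sets, $\mathcal{D}(u)$ denotes the class of finite unions of sets of $\mathcal{D}$. Indexing collection: a nonempty class $\mathcal{A}$ of compact connected subsets of $\mathcal{T}$ such that (1) $\emptyset\in\mathcal{A}$, and $A^\circ\neq A$ if $A\in\mathcal{A}$, $A\notin\{\emptyset,\mathcal{T}\}$; there is an increasing sequence $(B_n)_{n\in\mathbf{N}}$ in $\mathcal{A}(u)$ with $\mathcal{T}=\bigcup_n B_n^\circ$. (2) $\mathcal{A}$ is closed under arbitrary intersections; if $A,B\in\mathcal{A}$ are nonempty then $A\cap B\neq\emptyset$; if $(A_i)$ is an increasing sequence in $\mathcal{A}$ and there is $n$ with $A_i\subseteq B_n$ for all $i$, then $\overline{\bigcup_i A_i}\in\mathcal{A}$. (3) The $\sigma$-algebra generated by $\mathcal{A}$ is the Borel $\sigma$-algebra of $\mathcal{T}$. (4) (Separability from above) There exist an increasing sequence of finite subclasses $\mathcal{A}_n=\{A^n_1,\dots,A^n_{k_n}\}$ of $\mathcal{A}$, closed under intersections and satisfying $\emptyset,B_n\in\mathcal{A}_n(u)$, and functions $g_n:\mathcal{A}\to\mathcal{A}_n(u)\cup\{\mathcal{T}\}$ such that: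 (a) $g_n$ preserves arbitrary intersections and finite unions, i.e. $g_n(\bigcap_{A\in\mathcal{A}'}A)=\bigcap_{A\in\mathcal{A}'}g_n(A)$ for any $\mathcal{A}'\subseteq\mathcal{A}$, and if $\bigcup_{i=1}^kA_i=\bigcup_{j=1}^l A'_j$ then $\bigcup_{i=1}^k g_n(A_i)=\bigcup_{j=1}^l g_n(A'_j)$; (b) $A\subseteq(g_n(A))^\circ$ for each $A\in\mathcal{A}$; (c) $g_n(A)\subseteq g_k(A)$ if $n\ge k$; (d) $A=\bigcap_n g_n(A)$ for each $A\in\mathcal{A}$; (e) if $A,A'\in\mathcal{A}$ then $g_n(A)\cap A'\in\mathcal{A}$ for every $n$, and if $A'\in\mathcal{A}_n$ then $g_n(A)\cap A'\in\mathcal{A}_n$; (f) $g_n(\emptyset)=\emptyset$ for all $n$. (5) Every countable intersection of sets in $\mathcal{A}(u)$ may be expressed as the closure of a countable union of sets in $\mathcal{A}$. *)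

theory Defs
  imports "HOL-Analysis.Analysis"
begin

text \<open>The space is a metric type, so \<open>UNIV\<close> plays the role of the whole space.\<close>

definition radon_measure :: "'a::metric_space measure \<Rightarrow> bool" where
  "radon_measure m \<longleftrightarrow>
     sets m = sets borel \<and>
     (\<forall>K. compact K \<longrightarrow> emeasure m K < \<infinity>) \<and>
     (\<forall>S\<in>sets borel. emeasure m S = (SUP K\<in>{K. compact K \<and> K \<subseteq> S}. emeasure m K))"

text \<open>Finite unions $D_1 \cup \dots \cup D_k$ have $k \ge 1$ members; with the empty union
  included, the requirement that the empty set belongs to \<open>finite_unions (An n)\<close> in
  \<open>separable_from_above\<close> would be void.\<close>

definition finite_unions :: "'a set set \<Rightarrow> 'a set set" where
  "finite_unions D = {\<Union>F | F. F \<subseteq> D \<and> finite F \<and> F \<noteq> {}}"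

text \<open>All intersections are over nonempty subfamilies: the intersection of the empty
  family is the whole space, which need not be compact.\<close>

definition separable_from_above ::
    "'a::metric_space set set \<Rightarrow> (nat \<Rightarrow> 'a set) \<Rightarrow> bool" where
  "separable_from_above \<A> B \<longleftrightarrow>
     (\<exists>(An :: nat \<Rightarrow> 'a set set) (g :: nat \<Rightarrow> 'a set \<Rightarrow> 'a set).
        incseq An \<and>
        (\<forall>n. finite (An n) \<and> An n \<subseteq> \<A>) \<and>
        (\<forall>n. \<forall>F. F \<subseteq> An n \<and> F \<noteq> {} \<longrightarrow> \<Inter>F \<in> An n) \<and>
        (\<forall>n. {} \<in> finite_unions (An n) \<and> B n \<in> finite_unions (An n)) \<and>
        (\<forall>n. \<forall>A\<in>\<A>. g n A \<in> finite_unions (An n) \<union> {UNIV}) \<and>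
        (\<forall>n. \<forall>F. F \<subseteq> \<A> \<and> F \<noteq> {} \<longrightarrow> g n (\<Inter>F) = (\<Inter>A\<in>F. g n A)) \<and>
        (\<forall>n. \<forall>F G. F \<subseteq> \<A> \<and> finite F \<and> F \<noteq> {} \<and> G \<subseteq> \<A> \<and> finite G \<and> G \<noteq> {} \<and> \<Union>F = \<Union>G
               \<longrightarrow> (\<Union>A\<in>F. g n A) = (\<Union>A\<in>G. g n A)) \<and>
        (\<forall>n. \<forall>A\<in>\<A>. A \<subseteq> interior (g n A)) \<and>
        (\<forall>n k. \<forall>A\<in>\<A>. k \<le> n \<longrightarrow> g n A \<subseteq> g k A) \<and>
        (\<forall>A\<in>\<A>. A = (\<Inter>n. g n A)) \<and>
        (\<forall>n. \<forall>A\<in>\<A>. \<forall>A'\<in>\<A>. g n A \<inter> A' \<in> \<A>) \<and>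
        (\<forall>n. \<forall>A\<in>\<A>. \<forall>A'\<in>An n. g n A \<inter> A' \<in> An n) \<and>
        (\<forall>n. g n {} = {}))"

text \<open>The exhausting sequence \<open>B\<close> is shared by all conditions that mention it.\<close>

definition indexing_collection :: "'a::metric_space set set \<Rightarrow> bool" where
  "indexing_collection \<A> \<longleftrightarrow>
     \<A> \<noteq> {} \<and>
     (\<forall>A\<in>\<A>. compact A \<and> connected A) \<and>
     {} \<in> \<A> \<and>
     (\<forall>A\<in>\<A>. A \<notin> {{}, UNIV} \<longrightarrow> interior A \<noteq> A) \<and>
     (\<forall>F. F \<subseteq> \<A> \<and> F \<noteq> {} \<longrightarrow> \<Inter>F \<in> \<A>) \<and>
     (\<forall>A\<in>\<A>. \<forall>A'\<in>\<A>. A \<noteq> {} \<and> A' \<noteq> {} \<longrightarrow> A \<inter> A' \<noteq> {}) \<and>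
     sigma_sets UNIV \<A> = sets borel \<and>
     (\<forall>C :: nat \<Rightarrow> 'a set. range C \<subseteq> finite_unions \<A> \<longrightarrow>
        (\<exists>D :: nat \<Rightarrow> 'a set. range D \<subseteq> \<A> \<and> (\<Inter>i. C i) = closure (\<Union>i. D i))) \<and>
     (\<exists>B :: nat \<Rightarrow> 'a set.
        incseq B \<and> range B \<subseteq> finite_unions \<A> \<and> (\<Union>n. interior (B n)) = UNIV \<and>
        (\<forall>A :: nat \<Rightarrow> 'a set. incseq A \<and> range A \<subseteq> \<A> \<and> (\<exists>n. \<forall>i. A i \<subseteq> B n)
           \<longrightarrow> closure (\<Union>i. A i) \<in> \<A>) \<and>
        separable_from_above \<A> B)"

end

theory Submission imports Defs begin

text \<open>By separability from above, every \<open>A \<in> \<A>\<close> is the intersection of the sets \<open>g n A\<close>, which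
  all belong to the countable class consisting of the whole space and the finite unions of
  members of the finite classes \<open>An n\<close>. Hence \<open>A\<close> is determined by the members of this class
  that contain it, and a countable set has at most continuum many subsets.\<close>

lemma finite_finite_unions: "finite D \<Longrightarrow> finite (finite_unions D)"
  by (rule finite_subset[of _ "Union ` Pow D"]) (auto simp: finite_unions_def)

lemma lepoll_reals_if_Inter_of_countable:
  assumes "countable X" and "\<And>A. A \<in> \<A> \<Longrightarrow> \<exists>F\<subseteq>X. A = \<Inter>F"
  shows "\<A> \<lesssim> (UNIV :: real set)"
proof -
  \<comment> \<open>This replaces an arbitrary \<open>F\<close> by a canonical family:
    \<open>F\<close> lies in it, and all its members contain \<open>A\<close>, so the intersection
    is still \<open>A\<close>.\<close>
  have A_eq: "A = \<Inter>{S \<in> X. A \<subseteq> S}" if "A \<in> \<A>" for A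
    using assms(2)[OF that] by blast
  \<comment> \<open>Numbering \<open>X\<close> codes each canonical family as a set of naturals.
    \<open>to_nat_on X\<close> is injective on \<open>X\<close>, so the code gives back the family
    and, by \<open>A_eq\<close>, its intersection \<open>A\<close>.\<close>
  have "inj_on (\<lambda>A. to_nat_on X ` {S \<in> X. A \<subseteq> S}) \<A>"
  proof (rule inj_onI)
    fix A A'
    assume A: "A \<in> \<A>" "A' \<in> \<A>"
    assume "to_nat_on X ` {S \<in> X. A \<subseteq> S} = to_nat_on X ` {S \<in> X. A' \<subseteq> S}"
    then have "{S \<in> X. A \<subseteq> S} = {S \<in> X. A' \<subseteq> S}"
      by (subst (asm) inj_on_image_eq_iff[OF inj_on_to_nat_on[OF \<open>countable X\<close>]]) auto
    then show "A = A'"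
      by (subst A_eq[OF A(1)], subst A_eq[OF A(2)]) simp
  qed
  then have "\<A> \<lesssim> (UNIV :: nat set set)"
    unfolding lepoll_def by blast
  then show ?thesis
    using nat_sets_eqpoll_reals by (rule lepoll_trans2)
qed

text \<open>One \<open>X\<close> serves all of \<open>\<A>\<close>: at level \<open>n\<close> the
  values \<open>g n A\<close> range over a finite class that does not depend on \<open>A\<close>,
  and there are countably many levels.\<close>

lemma separable_from_above_Inter_of_countable:
  fixes \<A> :: "'a::metric_space set set"
  assumes "separable_from_above \<A> B"
  obtains X where "countable X" and "\<And>A. A \<in> \<A> \<Longrightarrow> \<exists>F\<subseteq>X. A = \<Inter>F"
proof -
  obtain An :: "nat \<Rightarrow> 'a set set" and g :: "nat \<Rightarrow> 'a set \<Rightarrow> 'a set"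
    where fin: "\<And>n. finite (An n)"
    and g: "\<forall>n. \<forall>A\<in>\<A>. g n A \<in> finite_unions (An n) \<union> {UNIV}"
    and A_eq: "\<forall>A\<in>\<A>. A = (\<Inter>n. g n A)"
    using assms unfolding separable_from_above_def by (elim exE conjE) (rule that; iprover)
  show thesis
  proof
    show "countable (\<Union>n. finite_unions (An n) \<union> {UNIV})"
      by (intro countable_UN countableI_type) (simp add: fin finite_finite_unions countable_finite)
    show "\<exists>F \<subseteq> (\<Union>n. finite_unions (An n) \<union> {UNIV}). A = \<Inter>F" if "A \<in> \<A>" for A
    proof (intro exI conjI)
      show "range (\<lambda>n. g n A) \<subseteq> (\<Union>n. finite_unions (An n) \<union> {UNIV})"
        using g that by blast
      show "A = (\<Inter>n. g n A)"
        using A_eq that by (rule bspec)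
    qed
  qed
qed

theorem corollary4p2:
  fixes m :: "'a::metric_space measure" and \<A> :: "'a set set"
  assumes "locally_compact_space (euclidean :: 'a topology)"
    and "radon_measure m"
    and "indexing_collection \<A>"
    and "\<forall>A\<in>\<A>. \<forall>B\<in>\<A>. A \<subseteq> B \<or> B \<subseteq> A"
  shows "\<A> \<lesssim> (UNIV :: real set)"
proof -
  obtain B where "separable_from_above \<A> B"
    using assms(3) unfolding indexing_collection_def by (elim conjE exE) (rule that)
  then obtain X where "countable X" and "\<And>A. A \<in> \<A> \<Longrightarrow> \<exists>F\<subseteq>X. A = \<Inter>F"
    by (rule separable_from_above_Inter_of_countable) (rule that)
  then show ?thesis
    by (rule lepoll_reals_if_Inter_of_countable)
qed

end
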